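(* Let $X$ be a separable infinite-dimensional Fréchet space and $T$ a continuous linear operator on $X$. Then \[UFHC(T)=\bigcup_{a\in\mathcal{A}}UFHC_a(T)=\bigcup_{a\in\mathcal{A}}FHC_a(T).\]
   Context: For a sequence $a=(a_n)_{n\ge 0}$ of positive real numbers with $\sum_{n=0}^\infty a_n=\infty$ and a set $I$ of non-negative integers, define \[\overline{d_a}(I)=\limsup_{N\to\infty}\frac{\sum_{n\in[0,N]\cap I}a_n}{\sum_{n=0}^N a_n},\qquad \underline{d_a}(I)=\liminf_{N\to\infty}\frac{\sum_{n\in[0,N]\cap I}a_n}{\sum_{n=0}^N a_n}.\] The unweighted upper and lower densities $\overline{d}$, $\underline{d}$ correspond to $a_n=1$ for all $n$. $\mathcal{A}$ denotes the set of all sequences $a=(a_n)_{n\ge0}$ of positive real numbers which are decreasing (in the wide sense, i.e. $a_{n+1}\le a_n$ for all $n$), tend to $0$, and satisfy $\sum_{n=0}^\infty a_n=\infty$. For $x\in X$ and $U\subset X$, put $N(x,U)=\{n\ge 0: T^nx\in U\}$. Then: - $UFHC(T)$ is the set of $x\in X$ such that $\overline{d}(N(x,U))>0$ for every non-empty open set $U\subset X$; - $FHC_a(T)$ is the set of $x\in X$ such that $\underline{d_a}(N(x,U))>0$ for every non-empty open set $U\subset X$; - $UFHC_a(T)$ is the set of $x\in X$ such that $\overline{d_a}(N(x,U))>0$ for every non-empty open set $U\subset X$. *)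

theory Defs
  imports "HOL-Analysis.Analysis"
begin

definition seminorm :: "('k::real_normed_field \<Rightarrow> 'a::ab_group_add \<Rightarrow> 'a) \<Rightarrow> ('a \<Rightarrow> real) \<Rightarrow> bool" where
  "seminorm smul p \<longleftrightarrow>
     (\<forall>x. 0 \<le> p x) \<and>
     (\<forall>x y. p (x + y) \<le> p x + p y) \<and>
     (\<forall>c x. p (smul c x) = norm c * p x)"

text \<open>
  A Frechet space: a vector space whose topology is induced by a countable separating family of
  seminorms for which it is complete.  The scalars range over an arbitrary \<^class>\<open>real_normed_field\<close>;
  by the Gelfand--Mazur theorem this means the real or the complex numbers.
\<close>

locale frechet_space = vector_space smul
  for smul :: "'k::real_normed_field \<Rightarrow> 'a::{ab_group_add,topological_space} \<Rightarrow> 'a" +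
  assumes frechet_seminorms:
    "\<exists>p :: nat \<Rightarrow> 'a \<Rightarrow> real.
       (\<forall>k. seminorm smul (p k)) \<and>
       (\<forall>x. (\<forall>k. p k x = 0) \<longrightarrow> x = 0) \<and>
       (\<forall>U. open U \<longleftrightarrow> (\<forall>x\<in>U. \<exists>n. \<exists>e>0. {y. \<forall>k\<le>n. p k (y - x) < e} \<subseteq> U)) \<and>
       (\<forall>X :: nat \<Rightarrow> 'a.
          (\<forall>k. \<forall>e>0. \<exists>M. \<forall>m\<ge>M. \<forall>n\<ge>M. p k (X m - X n) < e) \<longrightarrow> (\<exists>l. X \<longlonglongrightarrow> l))"

text \<open>
  The limits are taken in \<^typ>\<open>ereal\<close> because \<^const>\<open>limsup\<close> and \<^const>\<open>liminf\<close> need a complete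
  lattice; for positive weights the quotients lie in the unit interval.
\<close>

definition upper_density :: "(nat \<Rightarrow> real) \<Rightarrow> nat set \<Rightarrow> ereal" where
  "upper_density a I = limsup (\<lambda>N. ereal ((\<Sum>n\<in>{0..N} \<inter> I. a n) / (\<Sum>n=0..N. a n)))"

definition lower_density :: "(nat \<Rightarrow> real) \<Rightarrow> nat set \<Rightarrow> ereal" where
  "lower_density a I = liminf (\<lambda>N. ereal ((\<Sum>n\<in>{0..N} \<inter> I. a n) / (\<Sum>n=0..N. a n)))"

definition decreasing_weights :: "(nat \<Rightarrow> real) set" where
  "decreasing_weights =
     {a. (\<forall>n. 0 < a n) \<and> (\<forall>n. a (Suc n) \<le> a n) \<and> a \<longlonglongrightarrow> 0 \<and>
         filterlim (\<lambda>N. \<Sum>n=0..N. a n) at_top sequentially}"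

definition visit_times :: "('a \<Rightarrow> 'a) \<Rightarrow> 'a \<Rightarrow> 'a set \<Rightarrow> nat set" where
  "visit_times T x U = {n. (T ^^ n) x \<in> U}"

definition weighted_FHC :: "(nat \<Rightarrow> real) \<Rightarrow> ('a::topological_space \<Rightarrow> 'a) \<Rightarrow> 'a set" where
  "weighted_FHC a T = {x. \<forall>U. open U \<and> U \<noteq> {} \<longrightarrow> 0 < lower_density a (visit_times T x U)}"

definition weighted_UFHC :: "(nat \<Rightarrow> real) \<Rightarrow> ('a::topological_space \<Rightarrow> 'a) \<Rightarrow> 'a set" where
  "weighted_UFHC a T = {x. \<forall>U. open U \<and> U \<noteq> {} \<longrightarrow> 0 < upper_density a (visit_times T x U)}"

definition UFHC :: "('a::topological_space \<Rightarrow> 'a) \<Rightarrow> 'a set" where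
  "UFHC T = weighted_UFHC (\<lambda>n. 1) T"

end

theory Submission
  imports Defs "HOL-Real_Asymp.Real_Asymp"
begin

text \<open>
  The inclusion of \<^const>\<open>weighted_FHC\<close> in \<^const>\<open>weighted_UFHC\<close> is \<open>liminf \<le> limsup\<close>.  That decreasing
  weights produce no upper frequent hypercyclicity beyond the unweighted one
  (\<open>upper_density_pos_of_weighted\<close>) is summation by parts: a weighted sum with decreasing weights is
  a nonnegative combination of unweighted partial sums, so if those are negligible against their
  length, the weighted sum is negligible against the total weight.

  The substance is the remaining inclusion, which needs one weight that serves all open sets at once.
  A countable pi-base reduces this to countably many sets \<open>I k\<close> of positive upper density
  (\<open>separable_frechet_countable_pi_base\<close>).  Cut the naturals into blocks \<open>[e j, e (j + 1))\<close>, where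
  \<open>e (j + 1)\<close> is huge compared with \<open>e j\<close>, and spread a total weight of \<open>2 ^ j\<close> evenly over block
  \<open>j\<close>.  Rapid growth of \<open>e\<close> makes this weight decrease to 0.  If the end of block \<open>j\<close> is chosen
  among the times at which \<open>I k\<close> has large unweighted density, then \<open>I k\<close> captures a fixed fraction of
  \<open>2 ^ j\<close>, which is the order of magnitude of all the weight spent so far.  During the next \<open>p\<close>
  blocks the total grows by a factor of about \<open>2 ^ p\<close> only, so the fraction captured by \<open>I k\<close>
  remains bounded below provided that \<open>k\<close> gets its turn again within a bounded number of blocks.  The
  ruler sequence 0, 1, 0, 2, 0, 1, 0, 3, ... hands out turns to all \<open>k\<close> in this way
  (\<open>ruler_bounded_gaps\<close>).  The lower density obtained may tend to 0 as \<open>k\<close> grows, but it is positive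
  for each \<open>k\<close> (\<open>common_weight_lower_density_pos\<close>).
\<close>

section \<open>Comparing weighted and unweighted densities\<close>

text \<open>
  Summation by parts in the form of an induction: passing from \<open>a N\<close> to the smaller weight
  \<open>a (N + 1)\<close> can only decrease the product with the nonnegative partial sum of \<open>b\<close>.
\<close>

lemma abel_sum_nonneg:
  fixes a b :: "nat \<Rightarrow> real"
  assumes pos: "\<And>n. 0 \<le> a n" and dec: "\<And>n. a (Suc n) \<le> a n"
    and B: "\<And>N. 0 \<le> (\<Sum>n\<le>N. b n)"
  shows "0 \<le> (\<Sum>n\<le>N. a n * b n)"
proof -
  \<comment> \<open>The bare nonnegativity is not inductive; this stronger bound is.\<close>
  have "a N * (\<Sum>n\<le>N. b n) \<le> (\<Sum>n\<le>N. a n * b n)"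
  proof (induction N)
    case (Suc N)
    have "a (Suc N) * (\<Sum>n\<le>N. b n) \<le> a N * (\<Sum>n\<le>N. b n)"
      by (intro mult_right_mono dec B)
    with Suc show ?case by (simp add: algebra_simps)
  qed simp
  then show ?thesis using pos B by (smt (verit) mult_nonneg_nonneg)
qed

text \<open>With indicators the index range does not depend on \<open>I\<close>, so that sums can be split and compared.\<close>

lemma sum_Int_eq_sum_indicator:
  "(\<Sum>n\<in>{..N} \<inter> I. a n) = (\<Sum>n\<le>N. a n * indicator I n)" for a :: "nat \<Rightarrow> real"
  by (simp add: sum.inter_restrict indicator_def if_distrib cong: if_cong)

lemma upper_density_pos_imp_frequently:
  assumes "0 < upper_density a I"
  obtains d where "0 < d"
    "\<exists>\<^sub>F N in sequentially. d < (\<Sum>n\<le>N. a n * indicator I n) / (\<Sum>n\<le>N. a n)"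
proof -
  obtain d where d: "0 < ereal d" "ereal d < upper_density a I"
    using ereal_dense2[OF assms] by auto
  have "\<exists>\<^sub>F N in sequentially. ereal d < ereal ((\<Sum>n\<in>{0..N} \<inter> I. a n) / (\<Sum>n=0..N. a n))"
  proof (rule ccontr)
    assume "\<not> ?thesis"
    then have "upper_density a I \<le> ereal d"
      unfolding upper_density_def by (intro Limsup_bounded) (simp add: frequently_def not_less)
    with d(2) show False by simp
  qed
  then have "\<exists>\<^sub>F N in sequentially. d < (\<Sum>n\<le>N. a n * indicator I n) / (\<Sum>n\<le>N. a n)"
    by (simp only: sum_Int_eq_sum_indicator atLeast0AtMost ereal_less_eq(3)
          less_ereal.simps(1) not_less less_imp_le)
  then show thesis using that d by auto
qed

lemma frequently_imp_upper_density_pos: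
  assumes "0 < d"
    "\<exists>\<^sub>F N in sequentially. d < (\<Sum>n\<le>N. a n * indicator I n) / (\<Sum>n\<le>N. a n)"
  shows "0 < upper_density a I"
proof -
  have "ereal d \<le> upper_density a I"
    unfolding upper_density_def
  proof (rule ccontr)
    assume "\<not> ereal d \<le> limsup (\<lambda>N. ereal ((\<Sum>n\<in>{0..N} \<inter> I. a n) / (\<Sum>n=0..N. a n)))"
    then have "\<forall>\<^sub>F N in sequentially. ereal ((\<Sum>n\<in>{0..N} \<inter> I. a n) / (\<Sum>n=0..N. a n)) < ereal d"
      by (intro Limsup_lessD) auto
    then have "\<forall>\<^sub>F N in sequentially. \<not> d < (\<Sum>n\<le>N. a n * indicator I n) / (\<Sum>n\<le>N. a n)"
      by (rule eventually_mono) (simp only: sum_Int_eq_sum_indicator atLeast0AtMost ereal_less_eq(3)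
          less_ereal.simps(1) not_less less_imp_le)
    then show False using assms(2) by (simp add: frequently_def)
  qed
  then show ?thesis using assms(1) by (meson ereal_less(2) less_le_trans)
qed

text \<open>
  If the unweighted upper density vanished, \<open>I\<close> would have at most \<open>d / 2 * (N + 1)\<close> elements up to
  \<open>N\<close> for all \<open>N \<ge> C\<close>, hence at most \<open>d / 2 * (N + 1) + C\<close> for all \<open>N\<close>.  Summation by parts turns this
  into the bound \<open>d / 2 * S + a 0 * C\<close> for the weight of \<open>I\<close>, where \<open>S\<close> is the total weight.  Since
  \<open>S\<close> diverges, that is eventually at most \<open>d * S\<close>.
\<close>

lemma upper_density_pos_of_weighted:
  assumes a: "a \<in> decreasing_weights" and up: "0 < upper_density a I"
  shows "0 < upper_density (\<lambda>_. 1) I"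
proof (rule ccontr)
  assume neg: "\<not> 0 < upper_density (\<lambda>_. 1) I"
  from a have apos: "\<And>n. 0 < a n" and dec: "\<And>n. a (Suc n) \<le> a n"
    and inf: "filterlim (\<lambda>N. \<Sum>n\<le>N. a n) at_top sequentially"
    by (auto simp: decreasing_weights_def atLeast0AtMost)
  obtain d where d: "0 < d"
    and fr: "\<exists>\<^sub>F N in sequentially. d < (\<Sum>n\<le>N. a n * indicator I n) / (\<Sum>n\<le>N. a n)"
    using upper_density_pos_imp_frequently[OF up] .
  have "\<forall>\<^sub>F N in sequentially. (\<Sum>n\<le>N. indicator I n) / real (Suc N) \<le> d / 2"
  proof (rule ccontr)
    assume "\<not> ?thesis"
    then have "\<exists>\<^sub>F N in sequentially. d / 2 < (\<Sum>n\<le>N. 1 * indicator I n) / (\<Sum>n\<le>N. 1)"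
      by (simp add: frequently_def not_less)
    with neg d show False using frequently_imp_upper_density_pos[of "d / 2" "\<lambda>_. 1" I] by simp
  qed
  then obtain C where C: "\<And>N. N \<ge> C \<Longrightarrow> (\<Sum>n\<le>N. indicator I n) / real (Suc N) \<le> d / 2"
    by (auto simp: eventually_sequentially)
  \<comment> \<open>The extra mass \<open>C\<close> at 0 pays for the initial segment on which the density bound may fail.\<close>
  define b where "b n = d / 2 + (if n = 0 then real C else 0) - indicator I n" for n
  have sb: "(\<Sum>n\<le>N. c n * b n) = d / 2 * (\<Sum>n\<le>N. c n) + c 0 * C - (\<Sum>n\<le>N. c n * indicator I n)"
    for c N
  proof -
    have "(\<Sum>n\<le>N. c n * (if n = 0 then real C else 0)) = (\<Sum>n\<le>N. if n = 0 then c n * real C else 0)"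
      by (rule sum.cong) auto
    also have "\<dots> = c 0 * C" by simp
    finally show ?thesis
      by (simp add: b_def distrib_left right_diff_distrib sum.distrib sum_subtractf
          sum_distrib_left mult.commute)
  qed
  have "0 \<le> (\<Sum>n\<le>N. b n)" for N
  proof (cases "N \<ge> C")
    case True
    with C[OF this] sb[of "\<lambda>_. 1" N] show ?thesis by (simp add: field_simps)
  next
    case False
    have "(\<Sum>n\<le>N. indicator I n) \<le> (\<Sum>n\<le>N. 1::real)"
      by (intro sum_mono) (simp add: indicator_def)
    also have "\<dots> \<le> C" using False by simp
    finally have "(\<Sum>n\<le>N. indicator I n) \<le> real C" .
    moreover have "0 \<le> d / 2 * real (Suc N)" using d by simp
    ultimately show ?thesis using sb[of "\<lambda>_. 1" N] by simp
  qed
  from abel_sum_nonneg[of a b, OF _ dec this] apos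
  have "0 \<le> (\<Sum>n\<le>N. a n * b n)" for N by (simp add: less_imp_le)
  then have le: "(\<Sum>n\<le>N. a n * indicator I n) \<le> d / 2 * (\<Sum>n\<le>N. a n) + a 0 * C" for N
    using sb[of a N] by smt
  have "\<forall>\<^sub>F N in sequentially. (\<Sum>n\<le>N. a n) \<ge> 2 * (a 0 * C) / d"
    using inf by (simp add: filterlim_at_top)
  then have "\<forall>\<^sub>F N in sequentially. \<not> d < (\<Sum>n\<le>N. a n * indicator I n) / (\<Sum>n\<le>N. a n)"
  proof (rule eventually_mono)
    fix N assume "(\<Sum>n\<le>N. a n) \<ge> 2 * (a 0 * C) / d"
    then have "a 0 * C \<le> d / 2 * (\<Sum>n\<le>N. a n)" using d by (simp add: field_simps)
    with le[of N] have "(\<Sum>n\<le>N. a n * indicator I n) \<le> d * (\<Sum>n\<le>N. a n)" by simp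
    moreover have "0 < (\<Sum>n\<le>N. a n)" using apos by (intro sum_pos) auto
    ultimately show "\<not> d < (\<Sum>n\<le>N. a n * indicator I n) / (\<Sum>n\<le>N. a n)"
      by (simp add: field_simps not_less)
  qed
  then show False using fr by (simp add: frequently_def)
qed

lemma lower_density_le_upper_density: "lower_density a I \<le> upper_density a I"
  unfolding lower_density_def upper_density_def by (rule Liminf_le_Limsup) simp

lemma lower_density_posI:
  assumes "0 < c"
    "\<forall>\<^sub>F N in sequentially. c \<le> (\<Sum>n\<le>N. a n * indicator I n) / (\<Sum>n\<le>N. a n)"
  shows "0 < lower_density a I"
proof -
  have "ereal c \<le> lower_density a I"
    unfolding lower_density_def
    by (rule Liminf_bounded, rule eventually_mono[OF assms(2)])
      (simp only: sum_Int_eq_sum_indicator atLeast0AtMost ereal_less_eq(3)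
          less_ereal.simps(1) not_less less_imp_le)
  then show ?thesis using assms(1) by (meson ereal_less(2) less_le_trans)
qed

section \<open>Weights that are constant on rapidly growing blocks\<close>

text \<open>
  Block \<open>j\<close> is \<open>[e j, e (j + 1))\<close>.  The factor 5 makes block \<open>j + 1\<close> at least four times as long as
  block \<open>j\<close>; since it carries only twice the weight, the height at least halves from each block to
  the next.
\<close>

locale rapid_blocks =
  fixes e :: "nat \<Rightarrow> nat"
  assumes start: "e 0 = 0" and growth: "5 * e j < e (Suc j)"
begin

lemma e_less_Suc: "e j < e (Suc j)"
  using growth[of j] by linarith

lemma e_strict_mono: "strict_mono e"
  by (simp add: strict_mono_Suc_iff e_less_Suc)

definition height :: "nat \<Rightarrow> real" where
  "height j = 2 ^ j / (real (e (Suc j)) - real (e j))"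

definition block :: "nat \<Rightarrow> nat" where
  "block n = (LEAST j. n < e (Suc j))"

definition weight :: "nat \<Rightarrow> real" where
  "weight n = height (block n)"

lemma block_upper: "n < e (Suc (block n))"
proof -
  have "n < e (Suc n)" using strict_mono_imp_increasing[OF e_strict_mono, of "Suc n"] by simp
  then show ?thesis unfolding block_def by (rule LeastI)
qed

lemma block_lower: "e (block n) \<le> n"
proof (cases "block n")
  case 0
  then show ?thesis by (simp add: start)
next
  case (Suc j)
  then have "\<not> n < e (Suc j)" using not_less_Least[of j "\<lambda>j. n < e (Suc j)"] by (simp add: block_def)
  then show ?thesis using Suc by simp
qed

lemma block_eqI:
  assumes "e j \<le> n" "n < e (Suc j)"
  shows "block n = j"
proof -
  have "block n < Suc j" "j < Suc (block n)"
    using assms block_upper[of n] block_lower[of n] strict_mono_less[OF e_strict_mono]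
    by (meson le_less_trans)+
  then show ?thesis by simp
qed

lemma le_block: "e j \<le> n \<Longrightarrow> j \<le> block n"
  using block_upper[of n] strict_mono_less[OF e_strict_mono, of j "Suc (block n)"] by simp

lemma height_pos: "0 < height j"
  using e_less_Suc[of j] by (simp add: height_def)

lemma height_Suc: "height (Suc j) \<le> height j / 2"
proof -
  have 1: "4 * (real (e (Suc j)) - real (e j)) \<le> real (e (Suc (Suc j))) - real (e (Suc j))"
    using growth[of "Suc j"] by (simp flip: of_nat_less_iff[where 'a = real])
  have 2: "0 < real (e (Suc j)) - real (e j)" using e_less_Suc[of j] by simp
  have "2 ^ Suc j / (real (e (Suc (Suc j))) - real (e (Suc j)))
      \<le> 2 ^ Suc j / (4 * (real (e (Suc j)) - real (e j)))"
    using 1 2 by (intro divide_left_mono) auto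
  also have "\<dots> = height j / 2" by (simp add: height_def divide_simps)
  finally show ?thesis by (simp add: height_def)
qed

lemma height_le: "height j \<le> height 0 / 2 ^ j"
proof (induction j)
  case (Suc j)
  have "height (Suc j) \<le> height j / 2" by (rule height_Suc)
  also have "\<dots> \<le> (height 0 / 2 ^ j) / 2" using Suc by (rule divide_right_mono) simp
  finally show ?case by (simp add: mult.commute)
qed simp

lemma sum_weight_e: "(\<Sum>n<e j. weight n) = 2 ^ j - 1"
proof (induction j)
  case (Suc j)
  have "(\<Sum>n=e j..<e (Suc j). weight n) = (\<Sum>n=e j..<e (Suc j). height j)"
    by (intro sum.cong) (auto simp: weight_def block_eqI)
  also have "\<dots> = 2 ^ j" using e_less_Suc[of j] by (simp add: height_def of_nat_diff)
  moreover have "(\<Sum>n<e (Suc j). weight n) = (\<Sum>n<e j. weight n) + (\<Sum>n=e j..<e (Suc j). weight n)"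
    using e_less_Suc[of j] by (simp add: lessThan_atLeast0 sum.atLeastLessThan_concat)
  ultimately show ?case using Suc by simp
qed (simp add: start)

lemma weight_pos: "0 < weight n"
  by (simp add: weight_def height_pos)

lemma weight_decreasing: "weight (Suc n) \<le> weight n"
proof (cases "Suc n < e (Suc (block n))")
  case True
  then have "block (Suc n) = block n" using block_lower[of n] by (intro block_eqI) auto
  then show ?thesis by (simp add: weight_def)
next
  case False
  then have "Suc n = e (Suc (block n))" using block_upper[of n] by simp
  then have "block (Suc n) = Suc (block n)" using e_less_Suc by (intro block_eqI) auto
  then show ?thesis using height_Suc[of "block n"] height_pos[of "block n"] by (simp add: weight_def)
qed

lemma filterlim_block: "filterlim block at_top sequentially"
  unfolding filterlim_at_top using le_block eventually_ge_at_top
  by (metis (mono_tags, lifting) eventually_mono)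

lemma weight_in_decreasing_weights: "weight \<in> decreasing_weights"
proof -
  have "height \<longlonglongrightarrow> 0"
  proof (rule tendsto_sandwich[where f = "\<lambda>_. 0"])
    show "(\<lambda>j. height 0 / 2 ^ j) \<longlonglongrightarrow> 0" 
      using tendsto_mult_right_zero[OF LIMSEQ_power_zero[of "1 / 2 :: real"], of "height 0"]
      by (simp add: power_one_over field_simps)
  qed (auto simp: height_pos height_le less_imp_le intro: tendsto_const)
  then have "weight \<longlonglongrightarrow> 0"
    unfolding weight_def using filterlim_block by (rule filterlim_compose)
  moreover have "filterlim (\<lambda>N. \<Sum>n\<le>N. weight n) at_top sequentially"
  proof (rule filterlim_at_top_mono)
    have "filterlim (\<lambda>j. 2 ^ j - 1 :: real) at_top sequentially" by real_asymp
    then show "filterlim (\<lambda>N. 2 ^ block N - 1 :: real) at_top sequentially"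
      using filterlim_block by (rule filterlim_compose)
    show "\<forall>\<^sub>F N in sequentially. 2 ^ block N - 1 \<le> (\<Sum>n\<le>N. weight n)"
    proof (intro always_eventually allI)
      fix N
      have "(\<Sum>n<e (block N). weight n) \<le> (\<Sum>n\<le>N. weight n)"
        using block_lower[of N] weight_pos by (intro sum_mono2) (auto simp: less_imp_le)
      then show "2 ^ block N - 1 \<le> (\<Sum>n\<le>N. weight n)" by (simp add: sum_weight_e)
    qed
  qed
  ultimately show ?thesis
    by (simp add: decreasing_weights_def weight_pos weight_decreasing atLeast0AtMost)
qed

lemma sum_weight_le: "(\<Sum>n\<le>N. weight n) \<le> 2 ^ Suc (block N)"
proof -
  have "(\<Sum>n\<le>N. weight n) \<le> (\<Sum>n<e (Suc (block N)). weight n)"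
    using block_upper[of N] weight_pos by (intro sum_mono2) (auto simp: less_imp_le)
  also have "\<dots> \<le> 2 ^ Suc (block N)" unfolding sum_weight_e by simp
  finally show ?thesis .
qed

text \<open>
  The count up to the end of block \<open>j\<close> is at least \<open>d * e (j + 1)\<close>, and at most half of it can come
  from before the block.  So \<open>I\<close> fills a proportion of at least \<open>d / 2\<close> of block \<open>j\<close>, on which the
  weight is constant with sum \<open>2 ^ j\<close>.
\<close>

lemma sum_weight_indicator_ge:
  fixes d :: real
  assumes "0 \<le> d" and many: "d * e (Suc j) \<le> (\<Sum>n<e (Suc j). indicator I n)"
    and few: "e j \<le> d / 2 * e (Suc j)"
  shows "d / 2 * 2 ^ j \<le> (\<Sum>n<e (Suc j). weight n * indicator I n)"
proof -
  have split: "sum f {..<e (Suc j)} = sum f {..<e j} + sum f {e j..<e (Suc j)}" for f :: "nat \<Rightarrow> real"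
    using e_less_Suc[of j] by (simp add: lessThan_atLeast0 sum.atLeastLessThan_concat)
  have "(\<Sum>n<e j. indicator I n) \<le> (\<Sum>n<e j. 1::real)"
    by (intro sum_mono) (simp add: indicator_def)
  then have new: "d / 2 * e (Suc j) \<le> (\<Sum>n=e j..<e (Suc j). indicator I n)"
    using many few split[of "indicator I"] by simp
  have "d / 2 * 2 ^ j = height j * (d / 2 * (real (e (Suc j)) - real (e j)))"
    using e_less_Suc[of j] by (simp add: height_def)
  also have "\<dots> \<le> height j * (d / 2 * e (Suc j))"
    using height_pos[of j] \<open>0 \<le> d\<close> by (intro mult_left_mono) auto
  also have "\<dots> \<le> height j * (\<Sum>n=e j..<e (Suc j). indicator I n)"
    using new height_pos[of j] by (intro mult_left_mono) auto
  also have "\<dots> = (\<Sum>n=e j..<e (Suc j). weight n * indicator I n)"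
    unfolding sum_distrib_left by (intro sum.cong) (auto simp: weight_def block_eqI)
  also have "\<dots> \<le> (\<Sum>n<e (Suc j). weight n * indicator I n)"
    unfolding split[of "\<lambda>n. weight n * indicator I n"] using weight_pos
    by (simp add: sum_nonneg less_imp_le)
  finally show ?thesis .
qed

text \<open>
  At time \<open>N\<close>, look back at a block \<open>j\<close> that is good for \<open>I\<close>, completed, and at most \<open>p\<close>
  blocks before the current one: \<open>I\<close> captured at least \<open>d / 2 * 2 ^ j\<close> there, while the total weight
  up to \<open>N\<close> is at most \<open>2 ^ (j + p + 1)\<close>.
\<close>

lemma lower_density_weight_pos:
  fixes d :: real
  assumes d: "0 < d"
    and gaps: "\<And>m. \<exists>j\<in>{m..<m + p}. d * e (Suc j) \<le> (\<Sum>n<e (Suc j). indicator I n)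
                                \<and> e j \<le> d / 2 * e (Suc j)"
  shows "0 < lower_density weight I"
proof (rule lower_density_posI)
  show "0 < d / 2 / 2 ^ Suc p" using d by simp
  have "d / 2 / 2 ^ Suc p \<le> (\<Sum>n\<le>N. weight n * indicator I n) / (\<Sum>n\<le>N. weight n)"
    if "p \<le> block N" for N
  proof -
    define m where "m = block N - p"
    have m: "block N = m + p" using that by (simp add: m_def)
    obtain j where j: "m \<le> j" "j < m + p" and good: "d * e (Suc j) \<le> (\<Sum>n<e (Suc j). indicator I n)"
      "e j \<le> d / 2 * e (Suc j)"
      using gaps[of m] by auto
    have "e (Suc j) \<le> e (block N)"
      using j m strict_mono_less_eq[OF e_strict_mono] by simp
    then have eN: "e (Suc j) \<le> N" using block_lower[of N] by simp
    have "d / 2 / 2 ^ Suc p * (\<Sum>n\<le>N. weight n) \<le> d / 2 / 2 ^ Suc p * 2 ^ Suc (m + p)"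
      using sum_weight_le[of N] d m by (intro mult_left_mono) auto
    also have "\<dots> = d / 2 * 2 ^ m" by (simp add: power_add)
    also have "\<dots> \<le> d / 2 * 2 ^ j" using d j by (intro mult_left_mono power_increasing) auto
    also have "\<dots> \<le> (\<Sum>n<e (Suc j). weight n * indicator I n)"
      using sum_weight_indicator_ge[OF _ good] d by simp
    also have "\<dots> \<le> (\<Sum>n\<le>N. weight n * indicator I n)"
      using eN weight_pos by (intro sum_mono2) (auto simp: less_imp_le)
    finally have "d / 2 / 2 ^ Suc p * (\<Sum>n\<le>N. weight n) \<le> (\<Sum>n\<le>N. weight n * indicator I n)" .
    moreover have "0 < (\<Sum>n\<le>N. weight n)" using weight_pos by (intro sum_pos) auto
    ultimately show ?thesis by (simp add: pos_le_divide_eq)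
  qed
  then show "\<forall>\<^sub>F N in sequentially.
      d / 2 / 2 ^ Suc p \<le> (\<Sum>n\<le>N. weight n * indicator I n) / (\<Sum>n\<le>N. weight n)"
    using filterlim_block unfolding filterlim_at_top by (metis (mono_tags, lifting) eventually_mono)
qed

end

section \<open>One weight for countably many sets\<close>

text \<open>The exponent of 2 in \<open>n + 1\<close>; each value \<open>k\<close> recurs with period \<open>2 ^ (k + 1)\<close>.\<close>

function ruler :: "nat \<Rightarrow> nat" where
  "ruler n = (if even n then 0 else Suc (ruler (n div 2)))"
  by auto
termination
  by (relation "Wellfounded.measure id") (auto elim: oddE)

declare ruler.simps [simp del]

text \<open>
  At odd places \<open>2 * j + 1\<close> the sequence repeats itself with values raised by one, so the gaps of
  \<open>k + 1\<close> are twice those of \<open>k\<close>.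
\<close>

lemma ruler_bounded_gaps: "\<exists>p. \<forall>m. \<exists>j\<in>{m..<m + p}. ruler j = k"
proof (induction k)
  case 0
  have "\<exists>j\<in>{m..<m + 2}. ruler j = 0" for m
  proof (cases "even m")
    case True
    then show ?thesis by (intro bexI[of _ m]) (auto simp: ruler.simps[of m])
  next
    case False
    then show ?thesis by (intro bexI[of _ "Suc m"]) (auto simp: ruler.simps[of "Suc m"])
  qed
  then show ?case by blast
next
  case (Suc k)
  then obtain p where p: "\<And>m. \<exists>j\<in>{m..<m + p}. ruler j = k" by blast
  have "\<exists>j\<in>{m..<m + 2 * p}. ruler j = Suc k" for m
  proof -
    obtain j where "m div 2 \<le> j" "j < m div 2 + p" "ruler j = k" using p[of "m div 2"] by auto
    then show ?thesis
      by (intro bexI[of _ "2 * j + 1"]) (auto simp: ruler.simps[of "Suc (2 * j)"])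
  qed
  then show ?case by blast
qed

text \<open>
  The block ends are chosen recursively.  Positive upper density provides arbitrarily late times at
  which \<open>I k\<close> is dense, so density for the set whose turn it is can be combined with any growth
  condition relative to the previous block end.
\<close>

lemma common_weight_lower_density_pos:
  fixes I :: "nat \<Rightarrow> nat set"
  assumes up: "\<And>k. 0 < upper_density (\<lambda>_. 1) (I k)"
  shows "\<exists>a\<in>decreasing_weights. \<forall>k. 0 < lower_density a (I k)"
proof -
  have "\<exists>d>0. \<exists>\<^sub>F N in sequentially. d < (\<Sum>n\<le>N. indicator (I k) n) / real (Suc N)" for k
    using upper_density_pos_imp_frequently[OF up[of k]] by (simp add: add.commute) blast
  then obtain d where d: "\<And>k. 0 < d k"
    and fr: "\<And>k. \<exists>\<^sub>F N in sequentially. d k < (\<Sum>n\<le>N. indicator (I k) n) / real (Suc N)"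
    by metis
  have step: "\<exists>M. 5 * m < M \<and> d k * M \<le> (\<Sum>n<M. indicator (I k) n) \<and> m \<le> d k / 2 * M" for k and m :: nat
  proof -
    obtain N where N: "N \<ge> 5 * m + nat \<lceil>2 * m / d k\<rceil>"
      "d k < (\<Sum>n\<le>N. indicator (I k) n) / real (Suc N)"
      using fr[of k] unfolding frequently_sequentially by blast
    have "2 * m / d k \<le> real (Suc N)" using N(1) by linarith
    then have "m \<le> d k / 2 * Suc N" using d[of k] by (simp add: field_simps)
    moreover have "d k * Suc N \<le> (\<Sum>n<Suc N. indicator (I k) n)"
      using N(2) by (simp add: pos_less_divide_eq lessThan_Suc_atMost less_imp_le)
    ultimately show ?thesis using N(1) by (intro exI[of _ "Suc N"]) auto
  qed
  have "\<exists>e. \<forall>j. (j = 0 \<longrightarrow> e j = 0) \<and> (5 * e j < e (Suc j)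
      \<and> d (ruler j) * e (Suc j) \<le> (\<Sum>n<e (Suc j). indicator (I (ruler j)) n)
      \<and> e j \<le> d (ruler j) / 2 * e (Suc j))"
    by (rule dependent_nat_choice) (use step in auto)
  then obtain e where e0: "e 0 = 0" and growth: "\<And>j. 5 * e j < e (Suc j)"
    and good: "\<And>j. d (ruler j) * e (Suc j) \<le> (\<Sum>n<e (Suc j). indicator (I (ruler j)) n)
      \<and> e j \<le> d (ruler j) / 2 * e (Suc j)"
    by auto
  interpret rapid_blocks e by unfold_locales (fact e0 growth)+
  have "0 < lower_density weight (I k)" for k
  proof -
    obtain p where p: "\<And>m. \<exists>j\<in>{m..<m + p}. ruler j = k" using ruler_bounded_gaps by blast
    show ?thesis by (rule lower_density_weight_pos[OF d[of k], of p]) (use p good in metis)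
  qed
  then show ?thesis using weight_in_decreasing_weights by blast
qed

section \<open>Separable Frechet spaces have a countable pi-base\<close>

lemma seminorm_diff_triangle:
  assumes "seminorm smul p"
  shows "p (x - z) \<le> p (x - y) + p (y - z)"
  using assms unfolding seminorm_def by (metis diff_add_cancel add_diff_eq)

text \<open>
  The pi-base consists of the balls of radius \<open>1 / (n + 1)\<close> for the first \<open>n + 1\<close> seminorms, centred
  at the points of a countable dense set.  If a point \<open>z\<close> of that set is itself within
  \<open>1 / (n + 1)\<close> of \<open>x\<close>, its ball stays within \<open>2 / (n + 1)\<close> of \<open>x\<close>, by the triangle inequality.
\<close>

lemma separable_frechet_countable_pi_base:
  fixes smul :: "'k::real_normed_field \<Rightarrow> 'a::{ab_group_add,topological_space} \<Rightarrow> 'a"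
  assumes "frechet_space smul" and "separable_space (euclidean :: 'a topology)"
  obtains V :: "nat \<Rightarrow> 'a set" where "\<And>i. open (V i)" "\<And>i. V i \<noteq> {}"
    "\<And>U. open U \<Longrightarrow> U \<noteq> {} \<Longrightarrow> \<exists>i. V i \<subseteq> U"
proof -
  interpret frechet_space smul by fact
  obtain p :: "nat \<Rightarrow> 'a \<Rightarrow> real" where p': "\<forall>k. seminorm smul (p k)"
    and op': "\<forall>U. open U \<longleftrightarrow> (\<forall>x\<in>U. \<exists>n. \<exists>e>0. {y. \<forall>k\<le>n. p k (y - x) < e} \<subseteq> U)"
    using frechet_seminorms by (elim exE conjE) (rule that)
  note p = p'[rule_format] and op = op'[THEN spec]
  obtain D :: "'a set" where D: "countable D" "closure D = UNIV"
    using assms(2) by (auto simp: separable_space_def)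
  have p0: "p k 0 = 0" for k
    using p[of k] unfolding seminorm_def by (metis norm_zero mult_zero_left scale_zero_left)
  define ball where "ball = (\<lambda>(x, n). {y. \<forall>k\<le>n. p k (y - x) < 1 / Suc n})"
  have open_ball: "open (ball (x, n))" for x n
    unfolding op
  proof
    fix z assume z: "z \<in> ball (x, n)"
    define e where "e = Min ((\<lambda>k. 1 / Suc n - p k (z - x)) ` {..n})"
    have "e > 0" using z unfolding e_def by (subst Min_gr_iff) (auto simp: ball_def)
    moreover have "{y. \<forall>k\<le>n. p k (y - z) < e} \<subseteq> ball (x, n)"
    proof
      fix y assume y: "y \<in> {y. \<forall>k\<le>n. p k (y - z) < e}"
      have "p k (y - x) < 1 / Suc n" if "k \<le> n" for k
      proof -
        have "p k (y - z) < e" using y that by simp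
        also have "e \<le> 1 / Suc n - p k (z - x)"
          using that unfolding e_def by (intro Min_le) auto
        finally show ?thesis using seminorm_diff_triangle[OF p[of k], of y x z] by linarith
      qed
      then show "y \<in> ball (x, n)" by (simp add: ball_def)
    qed
    ultimately show "\<exists>n'. \<exists>e>0. {y. \<forall>k\<le>n'. p k (y - z) < e} \<subseteq> ball (x, n)" by blast
  qed
  have centre: "x \<in> ball (x, n)" for x n by (simp add: ball_def p0)
  have small: "\<exists>i\<in>D \<times> UNIV. ball i \<subseteq> U" if U: "open U" "U \<noteq> {}" for U
  proof -
    obtain x where x: "x \<in> U" using U by blast
    then obtain n e where e: "e > 0" "{y. \<forall>k\<le>n. p k (y - x) < e} \<subseteq> U"
      using op[of U] U(1) by blast
    obtain m where m: "1 / Suc m < e / 2" using e(1) nat_approx_posE[of "e/2"] by auto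
    \<comment> \<open>The index \<open>q\<close> controls the number of seminorms and the radius at the same time.\<close>
    define q where "q = max n m"
    have q: "1 / Suc q < e / 2"
      using m by (rule le_less_trans[rotated]) (simp add: q_def frac_le)
    have "ball (x, q) \<inter> D \<noteq> {}"
      using open_Int_closure_eq_empty[OF open_ball, of x q D] D centre[of x q] by auto
    then obtain z where z: "z \<in> D" "z \<in> ball (x, q)" by blast
    have "ball (z, q) \<subseteq> U"
    proof
      fix y assume y: "y \<in> ball (z, q)"
      have "p k (y - x) < e" if "k \<le> n" for k
      proof -
        have "k \<le> q" using that by (simp add: q_def)
        then have "p k (y - z) < 1 / Suc q" "p k (z - x) < 1 / Suc q"
          using y z by (auto simp: ball_def)
        then show ?thesis using seminorm_diff_triangle[OF p[of k], of y x z] q by linarith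
      qed
      then show "y \<in> U" using e by blast
    qed
    then show ?thesis using z by blast
  qed
  have cnt: "countable (D \<times> (UNIV :: nat set))" using D by simp
  have ne: "D \<times> (UNIV :: nat set) \<noteq> {}" using small[of UNIV] by auto
  show thesis
  proof (rule that[of "\<lambda>i. ball (from_nat_into (D \<times> UNIV) i)"])
    show "open (ball (from_nat_into (D \<times> UNIV) i))" for i
      by (cases "from_nat_into (D \<times> (UNIV :: nat set)) i") (simp add: open_ball)
    show "ball (from_nat_into (D \<times> UNIV) i) \<noteq> {}" for i
      using centre by (cases "from_nat_into (D \<times> (UNIV :: nat set)) i") auto
    show "\<exists>i. ball (from_nat_into (D \<times> UNIV) i) \<subseteq> U" if "open U" "U \<noteq> {}" for U
      using small[OF that] from_nat_into_surj[OF cnt] by metis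
  qed
qed

lemma lower_density_mono:
  assumes "\<And>n. 0 < a n" "I \<subseteq> J"
  shows "lower_density a I \<le> lower_density a J"
  unfolding lower_density_def
proof (intro Liminf_mono always_eventually allI)
  fix N
  have "(\<Sum>n\<in>{0..N} \<inter> I. a n) \<le> (\<Sum>n\<in>{0..N} \<inter> J. a n)"
    using assms by (intro sum_mono2) (auto simp: less_imp_le)
  then show "ereal ((\<Sum>n\<in>{0..N} \<inter> I. a n) / (\<Sum>n=0..N. a n))
      \<le> ereal ((\<Sum>n\<in>{0..N} \<inter> J. a n) / (\<Sum>n=0..N. a n))"
    using assms(1) by (simp add: divide_right_mono sum_nonneg less_imp_le)
qed

theorem corollary1p6:
  fixes smul :: "'k::real_normed_field \<Rightarrow> 'a::{ab_group_add,topological_space} \<Rightarrow> 'a"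
    and T :: "'a \<Rightarrow> 'a"
  assumes "frechet_space smul"
    and "separable_space (euclidean :: 'a topology)"
    and "\<not> (\<exists>B. finite_dimensional_vector_space smul B)"
    and "Vector_Spaces.linear smul smul T"
    and "continuous_on UNIV T"
  shows "UFHC T = (\<Union>a\<in>decreasing_weights. weighted_UFHC a T) \<and>
         (\<Union>a\<in>decreasing_weights. weighted_UFHC a T) = (\<Union>a\<in>decreasing_weights. weighted_FHC a T)"
proof -
  have lower: "weighted_FHC a T \<subseteq> weighted_UFHC a T" for a
    unfolding weighted_FHC_def weighted_UFHC_def
    by (auto intro: less_le_trans[OF _ lower_density_le_upper_density])
  have upper: "weighted_UFHC a T \<subseteq> UFHC T" if "a \<in> decreasing_weights" for a
    unfolding weighted_UFHC_def UFHC_def using upper_density_pos_of_weighted[OF that] by blast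
  have weight: "\<exists>a\<in>decreasing_weights. x \<in> weighted_FHC a T" if x: "x \<in> UFHC T" for x
  proof -
    obtain V :: "nat \<Rightarrow> 'a set" where V: "\<And>i. open (V i)" "\<And>i. V i \<noteq> {}"
      "\<And>U. open U \<Longrightarrow> U \<noteq> {} \<Longrightarrow> \<exists>i. V i \<subseteq> U"
      using separable_frechet_countable_pi_base[OF assms(1,2)] by blast
    have "0 < upper_density (\<lambda>_. 1) (visit_times T x (V i))" for i
      using x V by (simp add: UFHC_def weighted_UFHC_def)
    then obtain a where a: "a \<in> decreasing_weights"
      "\<And>i. 0 < lower_density a (visit_times T x (V i))"
      using common_weight_lower_density_pos[of "\<lambda>i. visit_times T x (V i)"] by blast
    have "0 < lower_density a (visit_times T x U)" if "open U" "U \<noteq> {}" for U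
    proof -
      obtain i where "V i \<subseteq> U" using V(3) \<open>open U\<close> \<open>U \<noteq> {}\<close> by blast
      then have "visit_times T x (V i) \<subseteq> visit_times T x U" by (auto simp: visit_times_def)
      then have "lower_density a (visit_times T x (V i)) \<le> lower_density a (visit_times T x U)"
        using a(1) by (intro lower_density_mono) (auto simp: decreasing_weights_def)
      with a(2)[of i] show ?thesis by (rule less_le_trans)
    qed
    then show ?thesis using a(1) by (auto simp: weighted_FHC_def)
  qed
  have "(\<Union>a\<in>decreasing_weights. weighted_FHC a T) \<subseteq> (\<Union>a\<in>decreasing_weights. weighted_UFHC a T)"
    by (rule UN_mono[OF order_refl lower])
  moreover have "(\<Union>a\<in>decreasing_weights. weighted_UFHC a T) \<subseteq> UFHC T"
    by (rule UN_least[OF upper])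
  moreover have "UFHC T \<subseteq> (\<Union>a\<in>decreasing_weights. weighted_FHC a T)"
    by (intro subsetI UN_iff[THEN iffD2] weight)
  ultimately show ?thesis by (intro conjI equalityI) (erule (1) order_trans | assumption)+
qed

end
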